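(* Suppose there exists a line segment $H$ with one end point in $F_l$ and the other in $F_r$, whose length equals the shortest distance between a point of $F_l$ and a point of $F_r$, and such that $H\subset F$. If all transmitters $T_1,\dots,T_M$ and all receivers $R_1,\dots,R_N$ are deployed at points of $H$, then the worst-case intrusion detectability equals the vulnerability of $H$, i.e. $B(P^* )=Q(H)$.
   Context: The field $F\subset\mathbb{R}^2$ is a bounded connected (closed) region enclosed by four curves, which in cyclic order along its boundary are: the left boundary $F_l$, the entrance side, the right boundary $F_r$, and the destination side (so $F$ is a closed Jordan region whose boundary is divided into four consecutive arcs; the curves may otherwise be arbitrary). An intrusion path is a continuous curve $P\subset F$ from a point of the entrance side to a point of the destination side. There are $M\ge 1$ transmitters located at points $T_1,\dots,T_M$ and $N\ge1$ receivers located at points $R_1,\dots,R_N$. $\|ab\|$ is the Euclidean distance. For a point $p$, $I(p)=\min_{i,j}\|T_ip\|\,\|R_jp\|$. For an intrusion path $P$, $B(P)=\min_{p\in P}I(p)$. The worst-case intrusion detectability $B(P^* )$ is the maximum (supremum) of $B(P)$ over all intrusion paths $P$. The vulnerability of a curve $U\subset F$ connecting $F_l$ and $F_r$ is $Q(U)=\max_{p\in U}I(p)$. *)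

theory Defs
  imports "HOL-Analysis.Analysis"
begin

text \<open>
  A closed Jordan region in the plane whose boundary curve runs through four consecutive
  arcs: left boundary, entrance side, right boundary, destination side. Simplicity of the
  concatenated loop forces each of the four pieces to be a (non-degenerate) arc and
  opposite sides to be disjoint; the orientation of the loop is left open.
\<close>

definition four_sided_field ::
  "(real^2) set \<Rightarrow> (real^2) set \<Rightarrow> (real^2) set \<Rightarrow> (real^2) set \<Rightarrow> (real^2) set \<Rightarrow> bool"
where
  "four_sided_field F Fl Fe Fr Fd \<longleftrightarrow>
    (\<exists>gl ge gr gd.
      pathfinish gl = pathstart ge \<and> pathfinish ge = pathstart gr \<and>
      pathfinish gr = pathstart gd \<and> pathfinish gd = pathstart gl \<and>
      simple_path (gl +++ ge +++ gr +++ gd) \<and>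
      Fl = path_image gl \<and> Fe = path_image ge \<and> Fr = path_image gr \<and> Fd = path_image gd \<and>
      F = (Fl \<union> Fe \<union> Fr \<union> Fd) \<union> inside (Fl \<union> Fe \<union> Fr \<union> Fd))"

definition intrusion_path ::
  "(real^2) set \<Rightarrow> (real^2) set \<Rightarrow> (real^2) set \<Rightarrow> (real \<Rightarrow> real^2) \<Rightarrow> bool"
where
  "intrusion_path F Fe Fd P \<longleftrightarrow>
    path P \<and> path_image P \<subseteq> F \<and> pathstart P \<in> Fe \<and> pathfinish P \<in> Fd"

text \<open>
  A deployment consists of transmitters \<open>T 1, \<dots>, T M\<close> and receivers \<open>R 1, \<dots>, R N\<close>;
  the values of \<open>T\<close> and \<open>R\<close> at other indices are irrelevant.
\<close>

definition intensity ::
  "nat \<Rightarrow> (nat \<Rightarrow> real^2) \<Rightarrow> nat \<Rightarrow> (nat \<Rightarrow> real^2) \<Rightarrow> real^2 \<Rightarrow> real"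
where
  "intensity M T N R p = (MIN (i, j) \<in> {1..M} \<times> {1..N}. dist (T i) p * dist (R j) p)"

text \<open>
  The minimum over a path and the maximum over a curve are written as infimum and supremum,
  since \<open>Min\<close> and \<open>Max\<close> are restricted to finite sets. They are attained on compact
  sets; see \<open>path_detectability_attained\<close> and \<open>vulnerability_attained\<close> below.
\<close>

definition path_detectability ::
  "nat \<Rightarrow> (nat \<Rightarrow> real^2) \<Rightarrow> nat \<Rightarrow> (nat \<Rightarrow> real^2) \<Rightarrow> (real \<Rightarrow> real^2) \<Rightarrow> real"
where
  "path_detectability M T N R P = (INF p \<in> path_image P. intensity M T N R p)"

definition worst_case_detectability ::
  "nat \<Rightarrow> (nat \<Rightarrow> real^2) \<Rightarrow> nat \<Rightarrow> (nat \<Rightarrow> real^2) \<Rightarrow>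
    (real^2) set \<Rightarrow> (real^2) set \<Rightarrow> (real^2) set \<Rightarrow> real"
where
  "worst_case_detectability M T N R F Fe Fd =
    (SUP P \<in> {P. intrusion_path F Fe Fd P}. path_detectability M T N R P)"

definition vulnerability ::
  "nat \<Rightarrow> (nat \<Rightarrow> real^2) \<Rightarrow> nat \<Rightarrow> (nat \<Rightarrow> real^2) \<Rightarrow> (real^2) set \<Rightarrow> real"
where
  "vulnerability M T N R U = (SUP p \<in> U. intensity M T N R p)"

lemma continuous_on_intensity:
  assumes "M \<ge> 1" "N \<ge> 1"
  shows "continuous_on S (intensity M T N R)"
proof -
  have Min_cont: "continuous_on S (\<lambda>p. Min ((\<lambda>k. f k p) ` K))"
    if "finite K" "K \<noteq> {}" "\<And>k. k \<in> K \<Longrightarrow> continuous_on S (f k)"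
    for f :: "nat \<times> nat \<Rightarrow> real^2 \<Rightarrow> real" and K
    using that
  proof (induction K rule: finite_ne_induct)
    case (insert x K)
    have "(\<lambda>p. Min ((\<lambda>k. f k p) ` insert x K)) = (\<lambda>p. min (f x p) (Min ((\<lambda>k. f k p) ` K)))"
      using insert.hyps by (simp add: fun_eq_iff)
    then show ?case
      using continuous_on_min[OF insert.prems[OF insertI1] insert.IH[OF insert.prems[OF insertI2]]]
      by (simp only:)
  qed simp
  have "continuous_on S (\<lambda>p. Min ((\<lambda>k. dist (T (fst k)) p * dist (R (snd k)) p) `
          ({1..M} \<times> {1..N})))"
    using assms by (intro Min_cont) (auto intro!: continuous_intros)
  then show ?thesis
    unfolding intensity_def case_prod_beta by simp
qed

lemma path_detectability_attained:
  assumes "M \<ge> 1" "N \<ge> 1" "path P"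
  shows "\<exists>p \<in> path_image P. path_detectability M T N R P = intensity M T N R p \<and>
           (\<forall>q \<in> path_image P. intensity M T N R p \<le> intensity M T N R q)"
proof -
  obtain p where p: "p \<in> path_image P"
      "\<forall>q \<in> path_image P. intensity M T N R p \<le> intensity M T N R q"
    using continuous_attains_inf[OF compact_path_image[OF assms(3)] path_image_nonempty
        continuous_on_intensity[OF assms(1,2)]] by blast
  then have "path_detectability M T N R P = intensity M T N R p"
    unfolding path_detectability_def by (intro cInf_eq_minimum) auto
  with p show ?thesis by blast
qed

lemma vulnerability_attained:
  assumes "M \<ge> 1" "N \<ge> 1" "compact U" "U \<noteq> {}"
  shows "\<exists>p \<in> U. vulnerability M T N R U = intensity M T N R p \<and>
           (\<forall>q \<in> U. intensity M T N R q \<le> intensity M T N R p)"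
proof -
  obtain p where p: "p \<in> U" "\<forall>q \<in> U. intensity M T N R q \<le> intensity M T N R p"
    using continuous_attains_sup[OF assms(3,4) continuous_on_intensity[OF assms(1,2)]] by blast
  then have "vulnerability M T N R U = intensity M T N R p"
    unfolding vulnerability_def by (intro cSup_eq_maximum) auto
  with p show ?thesis by blast
qed

text \<open>The supremum over intrusion paths ranges over a nonempty set that is bounded above.\<close>

lemma intrusion_path_exists:
  assumes "four_sided_field F Fl Fe Fr Fd"
  shows "\<exists>P. intrusion_path F Fe Fd P"
proof -
  obtain gl ge gr gd where g:
      "pathfinish gl = pathstart ge" "pathfinish ge = pathstart gr"
      "pathfinish gr = pathstart gd" "pathfinish gd = pathstart gl"
      "simple_path (gl +++ ge +++ gr +++ gd)"
      "Fe = path_image ge" "Fr = path_image gr" "Fd = path_image gd" "Fr \<subseteq> F"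
    using assms unfolding four_sided_field_def by blast
  have "path gr"
    using simple_path_imp_path[OF g(5)] g(1-4) by simp
  then have "intrusion_path F Fe Fd gr"
    unfolding intrusion_path_def using g
      pathstart_in_path_image[of gr] pathfinish_in_path_image[of ge]
      pathfinish_in_path_image[of gr] pathstart_in_path_image[of gd] by auto
  then show ?thesis by blast
qed

lemma path_detectability_bdd_above:
  assumes "M \<ge> 1" "N \<ge> 1" "four_sided_field F Fl Fe Fr Fd"
  shows "bdd_above (path_detectability M T N R ` {P. intrusion_path F Fe Fd P})"
proof -
  have cpt: "compact Fe"
    using assms(3) unfolding four_sided_field_def
    by (auto intro!: compact_path_image dest!: simple_path_imp_path)
  show ?thesis
  proof (cases "Fe = {}")
    case True
    then show ?thesis by (simp add: intrusion_path_def)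
  next
    case False
    then obtain e where e: "\<forall>q \<in> Fe. intensity M T N R q \<le> intensity M T N R e"
      using vulnerability_attained[OF assms(1,2) cpt] by blast
    have "path_detectability M T N R P \<le> intensity M T N R e" if "intrusion_path F Fe Fd P" for P
    proof -
      have "path P" "pathstart P \<in> Fe" using that by (auto simp: intrusion_path_def)
      then show ?thesis
        using path_detectability_attained[OF assms(1,2) \<open>path P\<close>, of T R] e
          pathstart_in_path_image[of P] by fastforce
    qed
    then show ?thesis by (intro bdd_aboveI2) auto
  qed
qed

end

theory Submission
  imports Defs
begin

text \<open>
  An intrusion path cannot avoid \<open>H = closed_segment a b\<close>, so its detectability is at most the
  intensity at some point of \<open>H\<close>. Conversely let \<open>p\<close> maximise the intensity on \<open>H\<close>, with value
  \<open>c\<close>, and let \<open>U\<close> be the set of points of the field of intensity at most \<open>c - \<epsilon>\<close>. On the perpendicular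
  to \<open>H\<close> at \<open>p\<close> every device is at least as far away as from \<open>p\<close>; so \<open>U\<close> misses this line, which splits it into
  a part on the side of \<open>a\<close> and a part on the side of \<open>b\<close>. As \<open>H\<close> realises the distance between
  the left and the right boundary, the first part misses the right boundary and the second one the left
  boundary. Hence the left boundary with the first part and the right boundary with the second
  part are disjoint compact sets, and some intrusion path runs between them, with detectability
  at least \<open>c - \<epsilon>\<close>. Both topological facts come from Janiszewski's theorem.
\<close>

section \<open>Jordan curves and Janiszewski's theorem in a Euclidean plane\<close>

text \<open>\<open>Janiszewski\<close> and \<open>Jordan_inside_outside\<close> concern subsets of
  the complex plane. A linear isomorphism preserves every notion occurring in them, so they carry
  over to any Euclidean space of dimension 2, in particular to \<open>real^2\<close>.\<close>

context
  fixes f :: "'a::euclidean_space \<Rightarrow> 'b::euclidean_space" and g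
  assumes lin: "linear f" "linear g" and gf: "\<And>x. g (f x) = x" and fg: "\<And>y. f (g y) = y"
begin

lemma bij_linear_iso: "bij f"
  using gf fg by (auto intro!: o_bij[of g])

lemma linear_iso_image_cancel: "g ` f ` S = S"
  by (simp add: gf image_image)

lemma connected_linear_iso_image: "connected (f ` S) \<longleftrightarrow> connected S"
  using connected_linear_image[OF lin(1), of S] connected_linear_image[OF lin(2), of "f ` S"]
  by (auto simp: linear_iso_image_cancel)

lemma connected_component_linear_iso_image:
  "connected_component (f ` S) (f x) (f y) \<longleftrightarrow> connected_component S x y"
proof
  assume "connected_component S x y"
  then obtain T where "connected T" "T \<subseteq> S" "x \<in> T" "y \<in> T"
    unfolding connected_component_def by blast
  then show "connected_component (f ` S) (f x) (f y)"
    unfolding connected_component_def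
    by (intro exI[of _ "f ` T"]) (auto simp: connected_linear_iso_image)
next
  assume "connected_component (f ` S) (f x) (f y)"
  then obtain T where T: "connected T" "T \<subseteq> f ` S" "f x \<in> T" "f y \<in> T"
    unfolding connected_component_def by blast
  then obtain U where U: "U \<subseteq> S" "T = f ` U"
    by (auto simp: subset_image_iff)
  then show "connected_component S x y"
    unfolding connected_component_def using T bij_linear_iso
    by (intro exI[of _ U]) (auto simp: connected_linear_iso_image bij_is_inj inj_image_mem_iff)
qed

lemma connected_component_set_linear_iso_image:
  "connected_component_set (f ` S) (f x) = f ` connected_component_set S x"
proof -
  have "y \<in> connected_component_set (f ` S) (f x) \<longleftrightarrow> y \<in> f ` connected_component_set S x" for y
  proof -
    obtain z where "y = f z" using bij_linear_iso by (metis bij_pointE)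
    then show ?thesis
      by (simp add: connected_component_linear_iso_image inj_image_mem_iff[OF bij_is_inj[OF bij_linear_iso]])
  qed
  then show ?thesis by blast
qed

lemma bounded_linear_iso_image: "bounded (f ` S) \<longleftrightarrow> bounded S"
  using bounded_linear_image[of S f] bounded_linear_image[of "f ` S" g] lin
  by (auto simp: linear_iso_image_cancel linear_conv_bounded_linear)

lemma inside_linear_iso_image: "inside (f ` S) = f ` inside S"
proof -
  have "f x \<in> inside (f ` S) \<longleftrightarrow> x \<in> inside S" for x
    by (simp add: inside_def inj_image_mem_iff[OF bij_is_inj[OF bij_linear_iso]] bounded_linear_iso_image
        connected_component_set_linear_iso_image flip: bij_image_Compl_eq[OF bij_linear_iso])
  then show ?thesis
    using bij_linear_iso by (auto simp: image_iff) (metis bij_pointE)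
qed

lemma outside_linear_iso_image: "outside (f ` S) = f ` outside S"
  using inside_linear_iso_image bij_linear_iso
  by (metis outside_inside bij_image_Compl_eq image_Un)

lemma frontier_linear_iso_image: "frontier (f ` S) = f ` frontier S"
  by (simp add: frontier_def closure_injective_linear_image interior_bijective_linear_image
      lin bij_linear_iso bij_is_inj image_set_diff)

end

theorem Janiszewski_plane:
  fixes a b :: "'a::euclidean_space"
  assumes dim: "DIM('a) = 2"
    and "compact S" "closed T" "connected (S \<inter> T)"
    and "connected_component (- S) a b" "connected_component (- T) a b"
  shows "connected_component (- (S \<union> T)) a b"
proof -
  obtain f :: "'a \<Rightarrow> complex" and g
    where iso: "linear f" "linear g" "\<And>x. g (f x) = x" "\<And>y. f (g y) = y"
    using isomorphisms_UNIV_UNIV[where 'M = 'a and 'N = complex] dim by (metis DIM_complex)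
  note f = iso(1) bij_linear_iso[OF iso]
  note tr = connected_component_linear_iso_image[OF iso] connected_linear_iso_image[OF iso]
    bij_image_Compl_eq[OF f(2)]
  have "connected_component (- (f ` S \<union> f ` T)) (f a) (f b)"
  proof (rule Janiszewski)
    show "compact (f ` S)"
      using assms f by (simp add: compact_continuous_image linear_continuous_on linear_linear)
    show "closed (f ` T)"
      using assms f by (simp add: closed_injective_linear_image bij_is_inj)
  qed (use assms in \<open>simp_all add: tr image_Int[OF bij_is_inj[OF f(2)], symmetric]
          flip: bij_image_Compl_eq[OF f(2)]\<close>)
  then show ?thesis
    by (simp add: tr flip: image_Un bij_image_Compl_eq[OF f(2)])
qed

lemma Jordan_inside_outside_plane:
  fixes c :: "real \<Rightarrow> 'a::euclidean_space"
  assumes dim: "DIM('a) = 2" and c: "simple_path c" "pathfinish c = pathstart c"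
  shows "connected (inside (path_image c))"
    and "frontier (inside (path_image c)) = path_image c"
    and "frontier (outside (path_image c)) = path_image c"
proof -
  obtain f :: "'a \<Rightarrow> complex" and g
    where iso: "linear f" "linear g" "\<And>x. g (f x) = x" "\<And>y. f (g y) = y"
    using isomorphisms_UNIV_UNIV[where 'M = 'a and 'N = complex] dim by (metis DIM_complex)
  note f = iso(1) bij_linear_iso[OF iso]
  have "simple_path (f \<circ> c)"
    using c f by (simp add: simple_path_linear_image_eq bij_is_inj)
  moreover have "pathfinish (f \<circ> c) = pathstart (f \<circ> c)"
    using c by (simp add: pathfinish_compose pathstart_compose)
  ultimately have J: "connected (inside (f ` path_image c))"
      "frontier (inside (f ` path_image c)) = f ` path_image c"
      "frontier (outside (f ` path_image c)) = f ` path_image c"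
    using Jordan_inside_outside[of "f \<circ> c"] by (simp_all add: path_image_compose)
  note tr = inside_linear_iso_image[OF iso] outside_linear_iso_image[OF iso]
    connected_linear_iso_image[OF iso] frontier_linear_iso_image[OF iso]
    inj_image_eq_iff[OF bij_is_inj[OF f(2)]]
  show "connected (inside (path_image c))"
    and "frontier (inside (path_image c)) = path_image c"
    and "frontier (outside (path_image c)) = path_image c"
    using J by (simp_all add: tr)
qed

section \<open>Crossing of connected sets\<close>

text \<open>Let \<open>t\<close> be the first time in \<open>B\<close> and then \<open>s\<close> the
  last time in \<open>A\<close> up to \<open>t\<close>; both exist by compactness of the preimages.
  Choosing in this order keeps the portion in between off both sets, however often the path returns
  to \<open>A\<close> or \<open>B\<close> elsewhere.\<close>

lemma path_last_first_exit:
  fixes p :: "real \<Rightarrow> 'a::topological_space"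
  assumes "path p" "closed A" "closed B" "pathstart p \<in> A" "pathfinish p \<in> B"
  obtains s t where "0 \<le> s" "s \<le> t" "t \<le> 1" "p s \<in> A" "p t \<in> B"
    "\<And>u. s < u \<Longrightarrow> u < t \<Longrightarrow> p u \<notin> A \<union> B"
proof -
  have cont: "continuous_on {0..1} p"
    using assms by (simp add: path_def)
  have cpt: "compact ({0..u} \<inter> p -` C)" if "closed C" "u \<le> 1" for C u
    using continuous_closed_preimage[OF continuous_on_subset[OF cont], of "{0..u}" C] that
    by (simp add: compact_eq_bounded_closed bounded_Int)
  have "1 \<in> {0..1} \<inter> p -` B"
    using assms(5) by (simp add: pathfinish_def)
  then obtain t where t: "t \<in> {0..1} \<inter> p -` B" "\<And>u. u \<in> {0..1} \<inter> p -` B \<Longrightarrow> t \<le> u"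
    using compact_attains_inf[OF cpt[OF assms(3) order_refl]] by (metis empty_iff)
  have "0 \<in> {0..t} \<inter> p -` A"
    using assms(4) t by (auto simp: pathstart_def)
  then obtain s where s: "s \<in> {0..t} \<inter> p -` A" "\<And>u. u \<in> {0..t} \<inter> p -` A \<Longrightarrow> u \<le> s"
    using compact_attains_sup[OF cpt[OF assms(2), of t]] t(1) by (metis IntD1 atLeastAtMost_iff empty_iff)
  show ?thesis
  proof (rule that[of s t])
    show "p u \<notin> A \<union> B" if "s < u" "u < t" for u
      using s(2)[of u] t(2)[of u] s(1) t(1) that by force
  qed (use s(1) t(1) in auto)
qed

text \<open>A connected set stays connected when a point of its closure is added. With
  \<open>D\<close> one side of a curve, a path that ends on the curve at \<open>y\<close> can thus
  be continued into that side, even if no path inside \<open>D\<close> leads to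
  \<open>y\<close>.\<close>

lemma connected_component_via_closure_point:
  assumes "connected C" "C \<subseteq> U" "x \<in> C" "y \<in> C"
    and "connected D" "D \<subseteq> U" "y \<in> closure D" "z \<in> D"
  shows "connected_component U x z"
proof -
  have "connected (insert y D)"
    using assms(5,7) closure_subset[of D] by (blast intro: connected_intermediate_closure)
  then have "connected (C \<union> insert y D)"
    using assms(1,4) by (blast intro: connected_Un)
  moreover have "C \<union> insert y D \<subseteq> U" "x \<in> C \<union> insert y D" "z \<in> C \<union> insert y D"
    using assms by blast+
  ultimately show ?thesis
    unfolding connected_component_def by blast
qed

text \<open>
  Otherwise a portion of the path from \<open>J1\<close> to \<open>J2\<close> through the side \<open>U\<close> can be
  joined to the other side \<open>V\<close> across \<open>J2\<close> without meeting \<open>J1 \<union> K\<close>, and across \<open>J1\<close> without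
  meeting \<open>J2 \<union> K\<close>. As \<open>(J1 \<union> K) \<inter> (J2 \<union> K) = K\<close> is connected, Janiszewski's theorem then joins
  \<open>U\<close> to \<open>V\<close> outside \<open>J1 \<union> J2\<close>. The path and \<open>K\<close> may touch \<open>J1 \<union> J2\<close> arbitrarily.
\<close>

lemma path_crosses_connected_set:
  fixes p :: "real \<Rightarrow> 'a::euclidean_space"
  assumes dim: "DIM('a) = 2"
    and J: "compact J1" "compact J2"
    and UV: "open U" "open V" "U \<inter> V = {}" "U \<union> V = - (J1 \<union> J2)" "connected V"
      "J1 \<union> J2 \<subseteq> closure V"
    and K: "compact K" "connected K" "K \<inter> V = {}" "J1 \<inter> J2 \<subseteq> K"
    and p: "path p" "path_image p \<inter> V = {}" "pathstart p \<in> J1" "pathfinish p \<in> J2"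
  shows "path_image p \<inter> K \<noteq> {}"
proof
  assume disj: "path_image p \<inter> K = {}"
  obtain s t where st: "0 \<le> s" "s \<le> t" "t \<le> 1" "p s \<in> J1" "p t \<in> J2"
      and mid: "\<And>u. s < u \<Longrightarrow> u < t \<Longrightarrow> p u \<notin> J1 \<union> J2"
    using path_last_first_exit[OF p(1) J[THEN compact_imp_closed] p(3,4)] by blast
  have img: "p u \<notin> K" "p u \<notin> V" if "u \<in> {s..t}" for u
  proof -
    have "p u \<in> path_image p"
      using that st by (auto simp: path_image_def)
    then show "p u \<notin> K" "p u \<notin> V"
      using disj p(2) by auto
  qed
  \<comment> \<open>A common point of \<open>J1\<close> and \<open>J2\<close> would lie in
    \<open>K\<close>, which the path avoids.\<close>
  have "s \<noteq> t"
    using st K(4) img(1)[of s] by auto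
  then have "s < t"
    using st by simp
  define m where "m = (s + t) / 2"
  have m: "s < m" "m < t"
    using \<open>s < t\<close> by (auto simp: m_def)
  have "p m \<in> U"
    using mid[OF m] img(2)[of m] m UV(4) by auto
  have "V \<noteq> {}"
    using UV(6) st(4) by auto
  then obtain v where "v \<in> V" by blast
  have cont: "continuous_on {s..t} p"
    using p(1) st by (auto simp: path_def intro: continuous_on_subset)
  have "connected_component (- ((J1 \<union> K) \<union> (J2 \<union> K))) (p m) v"
  proof (rule Janiszewski_plane[OF dim])
    show "compact (J1 \<union> K)" "closed (J2 \<union> K)"
      using J K by (auto intro: compact_Un closed_Un compact_imp_closed)
    have "(J1 \<union> K) \<inter> (J2 \<union> K) = K"
      using K(4) by blast
    then show "connected ((J1 \<union> K) \<inter> (J2 \<union> K))"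
      using K by simp
    show "connected_component (- (J1 \<union> K)) (p m) v"
    proof (rule connected_component_via_closure_point)
      show "connected (p ` {m..t})"
        using m by (intro connected_continuous_image continuous_on_subset[OF cont]) auto
      \<comment> \<open>Only the end \<open>t\<close> needs care: \<open>p t\<close> is in
        \<open>J2\<close>, so lying in \<open>J1\<close> as well would put it in
        \<open>K\<close>.\<close>
      have "p u \<notin> J1" if "u \<in> {m..t}" for u
        using mid[of u] st(5) img(1)[of t] K(4) m that by (cases "u = t") auto
      then show "p ` {m..t} \<subseteq> - (J1 \<union> K)"
        using img m by auto
      show "p t \<in> closure V"
        using UV(6) st(5) by blast
      show "V \<subseteq> - (J1 \<union> K)"
        using UV K(3) by blast
    qed (use m UV \<open>v \<in> V\<close> in auto)
    show "connected_component (- (J2 \<union> K)) (p m) v"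
    proof (rule connected_component_via_closure_point)
      show "connected (p ` {s..m})"
        using m by (intro connected_continuous_image continuous_on_subset[OF cont]) auto
      have "p u \<notin> J2" if "u \<in> {s..m}" for u
        using mid[of u] st(4) img(1)[of s] K(4) m that by (cases "u = s") auto
      then show "p ` {s..m} \<subseteq> - (J2 \<union> K)"
        using img m by auto
      show "p s \<in> closure V"
        using UV(6) st(4) by blast
      show "V \<subseteq> - (J2 \<union> K)"
        using UV K(3) by blast
    qed (use m UV \<open>v \<in> V\<close> in auto)
  qed
  then obtain C where "connected C" "C \<subseteq> U \<union> V" "p m \<in> C" "v \<in> C"
    unfolding connected_component_def UV(4) by blast
  then show False
    using connectedD[of C U V] UV \<open>p m \<in> U\<close> \<open>v \<in> V\<close> by blast
qed

text \<open>Accessible points are dense in the frontier of \<open>S \<inter> W\<close>, and inside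
  the open set \<open>W\<close> that frontier is part of the frontier of \<open>S\<close>. Working
  with \<open>S \<inter> W\<close> keeps the whole arc in \<open>W\<close>, not only its
  end.\<close>

lemma accessible_frontier_point_near:
  fixes S :: "'a::{complete_space,real_normed_vector} set"
  assumes S: "open S" "y \<in> frontier S" and W: "open W" "y \<in> W"
  obtains g where "arc g" "g ` {0..<1} \<subseteq> S \<inter> W" "pathfinish g \<in> frontier S \<inter> W"
proof -
  let ?V = "frontier (S \<inter> W) \<inter> W"
  have ope: "open (S \<inter> W)"
    using S(1) W(1) by (rule open_Int)
  note fr = frontier_def[of S, unfolded interior_open[OF S(1)]]
    frontier_def[of "S \<inter> W", unfolded interior_open[OF ope]]
  have sub: "?V \<subseteq> frontier S"
    unfolding fr using closure_mono[of "S \<inter> W" S] by blast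
  have "y \<in> closure (S \<inter> W)"
    using open_Int_closure_subset[OF W(1), of S] S(2) W(2) unfolding fr
    by (metis DiffD1 IntI Int_commute subsetD)
  then have "?V \<noteq> {}"
    using S(2) W(2) unfolding fr by blast
  then obtain g where "arc g" "g ` {0..<1} \<subseteq> S \<inter> W" "pathfinish g \<in> ?V"
    using dense_accessible_frontier_points[OF ope openin_open_Int[OF W(1)]] by metis
  then show ?thesis
    using that sub by blast
qed

lemma arc_not_subset_if_meets_ends_only:
  assumes "arc g" "path_image g \<inter> U \<subseteq> {pathstart g, pathfinish g}"
  shows "path_image g - U \<noteq> {}"
proof -
  have "g (1/2) \<noteq> g 0" "g (1/2) \<noteq> g 1"
    using arcD[OF assms(1), of "1/2" 0] arcD[OF assms(1), of "1/2" 1] by auto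
  moreover have "g (1/2) \<in> path_image g"
    by (simp add: path_image_def)
  ultimately show ?thesis
    using assms(2) unfolding pathstart_def pathfinish_def by blast
qed

section \<open>Jordan curves divided into four arcs\<close>

locale four_arc_loop =
  fixes gl ge gr gd :: "real \<Rightarrow> 'a::euclidean_space"
  assumes dim: "DIM('a) = 2"
    and ends: "pathfinish gl = pathstart ge" "pathfinish ge = pathstart gr"
      "pathfinish gr = pathstart gd" "pathfinish gd = pathstart gl"
    and simple: "simple_path (gl +++ ge +++ gr +++ gd)"
begin

abbreviation "L \<equiv> path_image gl"
abbreviation "E \<equiv> path_image ge"
abbreviation "R \<equiv> path_image gr"
abbreviation "D \<equiv> path_image gd"
abbreviation "J \<equiv> L \<union> E \<union> R \<union> D"

lemma loop_image: "path_image (gl +++ ge +++ gr +++ gd) = J"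
  using ends by (simp add: path_image_join Un_assoc)

text \<open>Peeling the arcs off the loop one by one turns simplicity into statements about the
  junction points. Opposite sides are disjoint because a common point would force one of
  \<open>ge\<close>, \<open>gr\<close>, \<open>gd\<close> to have equal end points.\<close>

lemma arcs: "arc gl" "arc ge" "arc gr" "arc gd"
  and meets: "L \<inter> E = {pathfinish gl}" "E \<inter> R = {pathfinish ge}"
    "R \<inter> D = {pathfinish gr}" "D \<inter> L = {pathfinish gd}"
  and disjoint_sides: "L \<inter> R = {}" "E \<inter> D = {}"
proof -
  have 1: "arc gl" "arc (ge +++ gr +++ gd)" "L \<inter> (E \<union> R \<union> D) \<subseteq> {pathstart gl, pathstart ge}"
    using simple simple_path_join_loop_eq[of "ge +++ gr +++ gd" gl] ends
    by (simp_all add: path_image_join Un_assoc)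
  then have 2: "arc ge" "arc (gr +++ gd)" "E \<inter> (R \<union> D) \<subseteq> {pathstart gr}"
    using ends by (simp_all add: arc_join_eq path_image_join)
  then have 3: "arc gr" "arc gd" "R \<inter> D \<subseteq> {pathstart gd}"
    using ends by (simp_all add: arc_join_eq)
  show arcs: "arc gl" "arc ge" "arc gr" "arc gd"
    using 1 2 3 by auto
  have mem: "pathfinish g \<in> path_image g" "pathstart g \<in> path_image g" for g :: "real \<Rightarrow> 'a"
    by auto
  note ne = arcs[THEN arc_distinct_ends]
  show "E \<inter> R = {pathfinish ge}" "R \<inter> D = {pathfinish gr}"
    using 2(3) 3(3) ends mem[of ge] mem[of gr] mem[of gd] by auto
  show "E \<inter> D = {}"
  proof -
    have "pathstart gr \<notin> D"
      using 3(3) ends ne(3) mem(2)[of gr] by auto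
    then show ?thesis
      using 2(3) by auto
  qed
  then have E: "pathstart gl \<notin> E" "pathstart ge \<notin> D"
    using ends mem(1)[of gd] mem(2)[of ge] by auto
  have "pathstart gl \<notin> R"
    using 3(3) ends ne(4) mem(1)[of gd] by auto
  moreover have "pathstart ge \<notin> R"
    using 2(3) ends ne(2) mem(2)[of ge] by auto
  ultimately show "L \<inter> R = {}"
    using 1(3) by auto
  show "L \<inter> E = {pathfinish gl}" "D \<inter> L = {pathfinish gd}"
    using 1(3) E ends mem[of gl] mem[of ge] mem[of gd] by auto
qed

lemma compact_sides: "compact L" "compact E" "compact R" "compact D"
  using arcs by (simp_all add: compact_arc_image)

lemma Jordan: "connected (inside J)" "frontier (inside J) = J" "frontier (outside J) = J"
    "open (inside J)" "open (outside J)" "connected (outside J)"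
proof -
  show "connected (inside J)" "frontier (inside J) = J" "frontier (outside J) = J"
    using Jordan_inside_outside_plane[OF dim simple] ends by (simp_all add: loop_image)
  have "compact J"
    using compact_sides by (intro compact_Un)
  then show "open (inside J)" "open (outside J)" "connected (outside J)"
    using dim compact_imp_closed compact_imp_bounded
    by (blast intro: open_inside open_outside connected_outside eq_refl[OF sym])+
qed

text \<open>The loop is cut at \<open>a\<close> and \<open>b\<close>: one piece is \<open>E\<close>
  with the adjacent parts of \<open>L\<close> and \<open>R\<close>, the other is \<open>D\<close>
  with the remaining parts. The points \<open>a\<close> and \<open>b\<close> may be corners of the
  loop.\<close>

lemma split_loop:
  assumes "a \<in> L" "b \<in> R"
  obtains J1 J2 where "compact J1" "compact J2" "J1 \<union> J2 = J" "E \<subseteq> J1" "D \<subseteq> J2" "J1 \<inter> J2 \<subseteq> {a, b}"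
proof -
  obtain u v where u: "u \<in> {0..1}" "a = gl u" and v: "v \<in> {0..1}" "b = gr v"
    using assms by (auto simp: path_image_def)
  define L1 L2 R1 R2 where "L1 = gl ` {u..1}" "L2 = gl ` {0..u}" "R1 = gr ` {0..v}" "R2 = gr ` {v..1}"
  note defs = this
  have cpt: "compact (g ` {s..t})" if "arc g" "0 \<le> s" "t \<le> 1" for g :: "real \<Rightarrow> 'a" and s t
    using that by (auto intro!: compact_continuous_image continuous_on_subset[of "{0..1}"]
        simp: arc_def path_def)
  have LR: "L1 \<union> L2 = L" "R1 \<union> R2 = R"
    using u v by (auto simp: defs path_image_def image_Un[symmetric] intro!: arg_cong2[of _ _ _ _ image])
  have sub: "L1 \<inter> L2 \<subseteq> {a}" "R1 \<inter> R2 \<subseteq> {b}"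
  proof -
    have "L1 \<inter> L2 = gl ` ({u..1} \<inter> {0..u})"
      unfolding defs using u(1) inj_on_image_Int[OF arc_imp_inj_on[OF arcs(1)], of "{u..1}" "{0..u}"]
      by simp
    moreover have "R1 \<inter> R2 = gr ` ({0..v} \<inter> {v..1})"
      unfolding defs using v(1) inj_on_image_Int[OF arc_imp_inj_on[OF arcs(3)], of "{0..v}" "{v..1}"]
      by simp
    moreover have "{u..1} \<inter> {0..u} \<subseteq> {u}" "{0..v} \<inter> {v..1} \<subseteq> {v}"
      by auto
    ultimately show "L1 \<inter> L2 \<subseteq> {a}" "R1 \<inter> R2 \<subseteq> {b}"
      using u(2) v(2) by auto
  qed
  have subsets: "L1 \<subseteq> L" "L2 \<subseteq> L" "R1 \<subseteq> R" "R2 \<subseteq> R"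
    using LR by auto
  \<comment> \<open>A corner is an end point of \<open>gl\<close>, so by injectivity it belongs to
    the part of \<open>L\<close> at the opposite end only if the cut was made at that
    corner.\<close>
  have "pathfinish gd \<in> L1 \<Longrightarrow> pathfinish gd = a" "pathfinish gl \<in> L2 \<Longrightarrow> pathfinish gl = a"
    using u arcD[OF arcs(1), of _ 0] arcD[OF arcs(1), of _ 1] ends
    unfolding defs pathstart_def pathfinish_def by force+
  moreover have "L1 \<inter> D \<subseteq> {pathfinish gd}" "E \<inter> L2 \<subseteq> {pathfinish gl}"
    using subsets(1,2) meets(1,4) by blast+
  ultimately have "L1 \<inter> D \<subseteq> {a}" "E \<inter> L2 \<subseteq> {a}"
    by auto
  have "pathfinish ge \<in> R2 \<Longrightarrow> pathfinish ge = b" "pathfinish gr \<in> R1 \<Longrightarrow> pathfinish gr = b"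
    using v arcD[OF arcs(3), of _ 0] arcD[OF arcs(3), of _ 1] ends
    unfolding defs pathstart_def pathfinish_def by force+
  moreover have "E \<inter> R2 \<subseteq> {pathfinish ge}" "R1 \<inter> D \<subseteq> {pathfinish gr}"
    using subsets(3,4) meets(2,3) by blast+
  ultimately have "E \<inter> R2 \<subseteq> {b}" "R1 \<inter> D \<subseteq> {b}"
    by auto
  note corners = this \<open>L1 \<inter> D \<subseteq> {a}\<close> \<open>E \<inter> L2 \<subseteq> {a}\<close>
  have "L1 \<inter> R2 = {}" "R1 \<inter> L2 = {}"
    using subsets disjoint_sides(1) by blast+
  then have "(L1 \<union> E \<union> R1) \<inter> (R2 \<union> D \<union> L2) \<subseteq> {a, b}"
    using sub disjoint_sides(2) corners by auto
  moreover have "compact (L1 \<union> E \<union> R1)" "compact (R2 \<union> D \<union> L2)"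
    using u v arcs compact_sides by (auto simp: defs intro!: compact_Un cpt)
  ultimately show ?thesis
    using LR by (intro that[of "L1 \<union> E \<union> R1" "R2 \<union> D \<union> L2"]) auto
qed

text \<open>The two pieces of \<open>split_loop\<close> meet at most in \<open>a\<close> and
  \<open>b\<close>, which lie in \<open>K\<close>, so \<open>path_crosses_connected_set\<close>
  applies. The interior case is the crossing property of the field; the exterior case serves to
  exclude detours outside it.\<close>

lemma crossing:
  assumes UV: "U = inside J \<and> V = outside J \<or> U = outside J \<and> V = inside J"
    and K: "compact K" "connected K" "K \<subseteq> J \<union> U" "a \<in> K \<inter> L" "b \<in> K \<inter> R"
    and p: "path p" "path_image p \<subseteq> J \<union> U" "pathstart p \<in> E" "pathfinish p \<in> D"
  shows "path_image p \<inter> K \<noteq> {}"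
proof -
  obtain J1 J2 where J12: "compact J1" "compact J2" "J1 \<union> J2 = J" "E \<subseteq> J1" "D \<subseteq> J2"
      "J1 \<inter> J2 \<subseteq> {a, b}"
    using split_loop K(4,5) by (metis IntD2)
  have part: "U \<inter> V = {}" "U \<union> V = - J" "(J \<union> U) \<inter> V = {}"
    using UV inside_Un_outside[of J] inside_Int_outside[of J] by blast+
  have VJ: "open U" "open V" "connected V" "J \<subseteq> closure V"
    using UV Jordan by (auto simp: frontier_def)
  show ?thesis
  proof (rule path_crosses_connected_set[OF dim J12(1,2)])
    show "open U" "open V" "connected V" "U \<inter> V = {}"
      by (fact VJ part)+
    show "U \<union> V = - (J1 \<union> J2)" "J1 \<union> J2 \<subseteq> closure V"
      using part VJ J12(3) by simp_all
    show "K \<inter> V = {}" "path_image p \<inter> V = {}"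
      using K(3) p(2) part(3) by blast+
    show "J1 \<inter> J2 \<subseteq> K"
      using J12(6) K(4,5) by blast
    show "pathstart p \<in> J1" "pathfinish p \<in> J2"
      using p J12 by blast+
  qed (fact K p)+
qed

text \<open>The side \<open>g\<close> has a point off the other sides \<open>U\<close>, hence off
  \<open>W\<close> too. It is a frontier point of the exterior, so some exterior point reaches the
  side nearby without touching \<open>U\<close> or \<open>W\<close>.\<close>

lemma accessible_point_of_side:
  assumes "arc g" "path_image g \<union> U = J" "path_image g \<inter> U \<subseteq> {pathstart g, pathfinish g}" "closed U"
    and "closed W" "path_image g \<inter> W \<subseteq> U"
  obtains h where "path h" "pathstart h \<in> outside J" "pathfinish h \<in> path_image g"
    "path_image h \<inter> (U \<union> W) = {}" "path_image h \<subseteq> insert (pathfinish h) (outside J)"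
proof -
  obtain y where y: "y \<in> path_image g" "y \<notin> U \<union> W"
    using arc_not_subset_if_meets_ends_only[OF assms(1,3)] assms(6) by blast
  then have "y \<in> frontier (outside J)"
    using assms(2) Jordan(3) by blast
  moreover have "open (- (U \<union> W))"
    using assms(4,5) by (intro open_Compl closed_Un)
  ultimately obtain h where h: "arc h" "h ` {0..<1} \<subseteq> outside J \<inter> - (U \<union> W)"
      "pathfinish h \<in> frontier (outside J) \<inter> - (U \<union> W)"
    using accessible_frontier_point_near[OF Jordan(5), of y "- (U \<union> W)"] y(2) by blast
  have img: "path_image h = insert (pathfinish h) (h ` {0..<1})"
  proof -
    have "{0..1} = insert 1 {0..<1::real}"
      by auto
    then show ?thesis
      unfolding path_image_def pathfinish_def by simp
  qed
  show ?thesis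
  proof (rule that[of h])
    show "path h"
      using h(1) by (rule arc_imp_path)
    show "pathstart h \<in> outside J"
      using h(2) unfolding pathstart_def by auto
    show "pathfinish h \<in> path_image g"
      using h(3) Jordan(3) assms(2) by blast
    show "path_image h \<inter> (U \<union> W) = {}" "path_image h \<subseteq> insert (pathfinish h) (outside J)"
      unfolding img using h(2,3) by auto
  qed
qed

text \<open>
  A crosscut \<open>x\<close> of the exterior from \<open>L\<close> to \<open>R\<close> is halved and the halves are added to \<open>A\<close> and
  \<open>B\<close>; the enlarged sets share a single point. Exterior points near \<open>E\<close> and \<open>D\<close> are separated by
  neither of them, hence by Janiszewski's theorem not by their union. A path joining these points off
  the union has a portion from \<open>E\<close> to \<open>D\<close> on one side of the loop; it cannot lie in the exterior, since there it
  would cross \<open>x\<close>.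
\<close>

lemma path_between_disjoint_compacts:
  assumes A: "compact A" "L \<subseteq> A" and B: "compact B" "R \<subseteq> B"
    and AB: "A \<inter> B = {}" "A \<union> B \<subseteq> J \<union> inside J"
  obtains p where "path p" "path_image p \<subseteq> J \<union> inside J" "pathstart p \<in> E" "pathfinish p \<in> D"
    "p ` {0<..<1} \<inter> (A \<union> B) = {}"
proof -
  let ?I = "inside J" and ?O = "outside J"
  have IO: "?I \<inter> ?O = {}" "?I \<union> ?O = - J"
    using inside_Un_outside[of J] inside_Int_outside[of J] by blast+
  have closed_sides: "closed L" "closed E" "closed R" "closed D"
    using compact_sides by (simp_all add: compact_imp_closed)
  have ne: "L - (E \<union> R \<union> D) \<noteq> {}" "R - (L \<union> E \<union> D) \<noteq> {}"
    using meets disjoint_sides ends arcs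
    by (intro arc_not_subset_if_meets_ends_only; auto)+
  \<comment> \<open>The parts of \<open>L\<close> and \<open>R\<close> off the other sides are
    nonempty, relatively open in the loop and distinct. Density of accessible pairs yields the
    crosscut \<open>x\<close> between them.\<close>
  have "open (- (E \<union> R \<union> D))" "open (- (L \<union> E \<union> D))"
    using closed_sides by auto
  then have "openin (top_of_set (frontier ?O)) (J \<inter> - (E \<union> R \<union> D))"
    "openin (top_of_set (frontier ?O)) (J \<inter> - (L \<union> E \<union> D))"
    unfolding Jordan(3) by (simp_all only: openin_open_Int)
  moreover have "J \<inter> - (E \<union> R \<union> D) \<noteq> {}" "J \<inter> - (L \<union> E \<union> D) \<noteq> {}"
      "J \<inter> - (E \<union> R \<union> D) \<noteq> J \<inter> - (L \<union> E \<union> D)"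
    using ne by blast+
  ultimately obtain x where x': "arc x" "pathstart x \<in> J \<inter> - (E \<union> R \<union> D)"
      "pathfinish x \<in> J \<inter> - (L \<union> E \<union> D)" "x ` {0<..<1} \<subseteq> ?O"
    by (rule dense_accessible_frontier_point_pairs[OF Jordan(5,6)])
  then have x: "arc x" "pathstart x \<in> L" "pathfinish x \<in> R" "x ` {0<..<1} \<subseteq> ?O"
    by auto
  have x01: "x 0 \<in> L" "x 1 \<in> R"
    using x by (simp_all add: pathstart_def pathfinish_def)
  define XA XB where "XA = x ` {0..1/2}" and "XB = x ` {1/2..1}"
  have halves: "arc (subpath 0 (1/2) x)" "arc (subpath (1/2) 1 x)"
      "path_image (subpath 0 (1/2) x) = XA" "path_image (subpath (1/2) 1 x) = XB"
    using x(1) by (simp_all add: arc_subpath_arc path_image_subpath XA_def XB_def)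
  have X: "path_image x = XA \<union> XB"
    unfolding XA_def XB_def path_image_def image_Un[symmetric]
    by (intro arg_cong2[of _ _ _ _ image]) auto
  have inO: "x t \<in> ?O" if "0 < t" "t < 1" for t
    using x(4) that by auto
  have XA_sub: "XA \<subseteq> insert (x 0) ?O"
  proof
    fix z assume "z \<in> XA"
    then obtain t where "z = x t" "0 \<le> t" "t \<le> 1/2" by (auto simp: XA_def)
    then show "z \<in> insert (x 0) ?O"
      using inO[of t] by (cases "t = 0") auto
  qed
  have XB_sub: "XB \<subseteq> insert (x 1) ?O"
  proof
    fix z assume "z \<in> XB"
    then obtain t where "z = x t" "1/2 \<le> t" "t \<le> 1" by (auto simp: XB_def)
    then show "z \<in> insert (x 1) ?O"
      using inO[of t] by (cases "t = 1") auto
  qed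
  have mem: "x 0 \<in> XA" "x 1 \<in> XB" "x (1/2) \<in> XA" "x (1/2) \<in> XB"
    by (auto simp: XA_def XB_def)
  have JX: "J \<inter> XA = {x 0}" "J \<inter> XB = {x 1}"
    using XA_sub XB_sub mem x01 IO by blast+
  have IX: "?I \<inter> XA = {}" "?I \<inter> XB = {}"
    using XA_sub XB_sub x01 IO by blast+
  have XAB: "XA \<inter> XB = {x (1/2)}"
  proof -
    have "XA \<inter> XB = x ` ({0..1/2} \<inter> {1/2..1})"
      unfolding XA_def XB_def using x(1)
      by (intro inj_on_image_Int[symmetric, of _ "{0..1}"] arc_imp_inj_on) auto
    also have "{0..1/2} \<inter> {1/2..1} = {1/2::real}"
      by auto
    finally show ?thesis by simp
  qed
  have closed_X: "closed (path_image x)" "closed XA" "closed XB"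
    using x(1) halves by (metis closed_arc_image)+
  obtain h where h: "path h" "pathstart h \<in> ?O" "pathfinish h \<in> E"
      "path_image h \<inter> (L \<union> R \<union> D \<union> path_image x) = {}"
      "path_image h \<subseteq> insert (pathfinish h) ?O"
  proof (rule accessible_point_of_side)
    show "arc ge" "E \<union> (L \<union> R \<union> D) = J" "closed (L \<union> R \<union> D)" "closed (path_image x)"
      using arcs closed_sides closed_X by auto
    show "E \<inter> (L \<union> R \<union> D) \<subseteq> {pathstart ge, pathfinish ge}"
      using meets disjoint_sides ends by auto
    show "E \<inter> path_image x \<subseteq> L \<union> R \<union> D"
      using X JX x01 by blast
  qed
  obtain k where k: "path k" "pathstart k \<in> ?O" "pathfinish k \<in> D"
      "path_image k \<inter> (L \<union> E \<union> R \<union> path_image x) = {}"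
      "path_image k \<subseteq> insert (pathfinish k) ?O"
  proof (rule accessible_point_of_side)
    show "arc gd" "D \<union> (L \<union> E \<union> R) = J" "closed (L \<union> E \<union> R)" "closed (path_image x)"
      using arcs closed_sides closed_X by auto
    show "D \<inter> (L \<union> E \<union> R) \<subseteq> {pathstart gd, pathfinish gd}"
      using meets disjoint_sides ends by auto
    show "D \<inter> path_image x \<subseteq> L \<union> E \<union> R"
      using X JX x01 by blast
  qed
  define e d where "e = pathstart h" and "d = pathstart k"
  have notX: "e \<notin> path_image x" "d \<notin> path_image x"
    using h(4) k(4) by (auto simp: e_def d_def)
  \<comment> \<open>Half of the crosscut meets the loop in one point, and neither set separates
    \<open>e\<close> from \<open>d\<close>: both are exterior points, and an arc does not separate
    the plane. So Janiszewski's theorem applies to the loop and the half.\<close>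
  have half: "connected_component (- (Y \<union> path_image q)) e d"
    if "Y \<subseteq> J \<union> ?I" "arc q" "J \<inter> path_image q = {z}" "path_image q \<subseteq> path_image x" for Y q z
  proof -
    have "connected_component (- (J \<union> path_image q)) e d"
    proof (rule Janiszewski_plane[OF dim])
      show "compact J"
        using compact_sides by (intro compact_Un)
      show "closed (path_image q)"
        using that(2) by (rule closed_arc_image)
      show "connected (J \<inter> path_image q)"
        using that(3) by simp
      show "connected_component (- J) e d"
        unfolding connected_component_def using Jordan(6) IO h(2) k(2) e_def d_def by blast
      have "connected (- path_image q)"
        using connected_arc_complement[OF that(2)] dim by simp
      then show "connected_component (- path_image q) e d"
        unfolding connected_component_def using notX that(4) by blast
    qed
    then obtain C where C: "connected C" "C \<subseteq> - (J \<union> path_image q)" "e \<in> C" "d \<in> C"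
      unfolding connected_component_def by blast
    \<comment> \<open>\<open>C\<close> avoids the loop and contains the exterior point
      \<open>e\<close>, so it stays in the exterior and thus misses \<open>Y\<close>.\<close>
    then have "C \<inter> ?I = {}"
      using connectedD[OF C(1) Jordan(4,5)] IO h(2) e_def by blast
    then show ?thesis
      unfolding connected_component_def using C that(1) by blast
  qed
  have "connected_component (- ((A \<union> XA) \<union> (B \<union> XB))) e d"
  proof (rule Janiszewski_plane[OF dim])
    have "compact XA"
      using halves by (metis compact_arc_image)
    then show "compact (A \<union> XA)" "closed (B \<union> XB)"
      using A(1) B(1) closed_X by (auto intro: compact_Un closed_Un compact_imp_closed)
    \<comment> \<open>A half of the crosscut meets the field only in its end on the loop, and that
      end already belongs to the set which the half is added to.\<close>
    have "A \<inter> XB \<subseteq> {x 1}" "XA \<inter> B \<subseteq> {x 0}"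
      using JX IX AB(2) by blast+
    moreover have "x 1 \<notin> A" "x 0 \<notin> B"
      using AB(1) A(2) B(2) x01 by blast+
    ultimately have "A \<inter> XB = {}" "XA \<inter> B = {}"
      by auto
    then have "(A \<union> XA) \<inter> (B \<union> XB) = {x (1/2)}"
      using XAB AB(1) by blast
    then show "connected ((A \<union> XA) \<inter> (B \<union> XB))"
      by simp
    show "connected_component (- (A \<union> XA)) e d"
      using half[OF _ halves(1), of A] AB(2) JX(1) X by (simp add: halves)
    show "connected_component (- (B \<union> XB)) e d"
      using half[OF _ halves(2), of B] AB(2) JX(2) X by (simp add: halves)
  qed
  moreover have "open (- ((A \<union> XA) \<union> (B \<union> XB)))"
    using A(1)[THEN compact_imp_closed] B(1)[THEN compact_imp_closed] closed_X
    by (intro open_Compl closed_Un)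
  ultimately obtain c where c: "path c" "path_image c \<subseteq> - ((A \<union> XA) \<union> (B \<union> XB))"
      "pathstart c = e" "pathfinish c = d"
    using open_path_connected_component by (metis path_component_def)
  define p where "p = reversepath h +++ c +++ k"
  have p: "path p" "pathstart p \<in> E" "pathfinish p \<in> D"
    using h(1,3) c k(1,3) by (simp_all add: p_def e_def d_def)
  have p_image: "path_image p = path_image h \<union> path_image c \<union> path_image k"
    using c by (simp add: p_def e_def d_def path_image_join Un_assoc)
  \<comment> \<open>Hence \<open>p\<close> can meet the loop only in \<open>E\<close> and
    \<open>D\<close>, and a portion that avoids these two lies on one side of the loop.\<close>
  have p_avoids: "path_image p \<inter> (L \<union> R \<union> path_image x) = {}"
    unfolding p_image using h(4) k(4) c(2) A(2) B(2) X by blast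
  obtain s t where st: "0 \<le> s" "s \<le> t" "t \<le> 1" "p s \<in> E" "p t \<in> D"
      and mid: "\<And>u. s < u \<Longrightarrow> u < t \<Longrightarrow> p u \<notin> E \<union> D"
    using path_last_first_exit[OF p(1) closed_sides(2,4) p(2,3)] by blast
  have "s \<noteq> t"
    using st disjoint_sides by auto
  then have "s < t"
    using st by simp
  have in_image: "p u \<in> path_image p" if "u \<in> {s..t}" for u
    using that st by (auto simp: path_image_def)
  have mid_sub: "p ` {s<..<t} \<subseteq> - J"
  proof
    fix z assume "z \<in> p ` {s<..<t}"
    then obtain u where "z = p u" "s < u" "u < t" by auto
    then show "z \<in> - J"
      using mid[of u] in_image[of u] p_avoids by auto
  qed
  have conn: "connected (p ` {s<..<t})"
  proof (rule connected_continuous_image)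
    have "{s<..<t} \<subseteq> {0..1}"
      using st by auto
    then show "continuous_on {s<..<t} p"
      using p(1) continuous_on_subset unfolding path_def by blast
  qed simp
  define q where "q = subpath s t p"
  have q_image: "path_image q = {p s, p t} \<union> p ` {s<..<t}"
  proof -
    have "{s..t} = {s, t} \<union> {s<..<t}"
      using \<open>s < t\<close> by auto
    then show ?thesis
      using st by (simp add: q_def path_image_subpath)
  qed
  have q: "path q" "pathstart q \<in> E" "pathfinish q \<in> D"
    using p(1) st by (simp_all add: q_def)
  have q_mid: "q ` {0<..<1} \<subseteq> p ` {s<..<t}"
  proof
    fix z assume "z \<in> q ` {0<..<1}"
    then obtain u where u: "0 < u" "u < 1" "z = p ((t - s) * u + s)"
      by (auto simp: q_def subpath_def)
    then have "0 < (t - s) * u" "(t - s) * u < t - s"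
      using mult_strict_left_mono[of u 1 "t - s"] \<open>s < t\<close> by simp_all
    then show "z \<in> p ` {s<..<t}"
      unfolding u(3) by (intro imageI) auto
  qed
  have "\<not> p ` {s<..<t} \<subseteq> ?O"
  proof
    assume "p ` {s<..<t} \<subseteq> ?O"
    then have sub: "path_image q \<subseteq> J \<union> ?O"
      using q_image st by auto
    have "path_image q \<inter> path_image x \<noteq> {}"
    proof (rule crossing[OF disjI2])
      show "?O = ?O \<and> ?I = ?I" by simp
      show "compact (path_image x)" "connected (path_image x)"
        using x(1) by (simp_all add: compact_arc_image connected_arc_image)
      show "path_image x \<subseteq> J \<union> ?O"
        using X XA_sub XB_sub x01 by blast
      show "x 0 \<in> path_image x \<inter> L" "x 1 \<in> path_image x \<inter> R"
        using x01 X mem by auto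
    qed (fact q sub)+
    moreover have "path_image q \<subseteq> path_image p"
      using st unfolding q_def by (intro path_image_subpath_subset) auto
    ultimately show False
      using p_avoids by blast
  qed
  then have sub: "p ` {s<..<t} \<subseteq> ?I"
    using connectedD[OF conn Jordan(4,5)] mid_sub IO by blast
  \<comment> \<open>The connecting paths \<open>h\<close> and \<open>k\<close> never enter the
    interior, so the open portion comes from \<open>c\<close>, which avoids \<open>A\<close> and
    \<open>B\<close>. The end points of \<open>q\<close> may lie in \<open>A\<close> or
    \<open>B\<close>, since these may contain points of \<open>E\<close> and
    \<open>D\<close>.\<close>
  have "p ` {s<..<t} \<subseteq> path_image c"
  proof -
    have "p ` {s<..<t} \<subseteq> path_image h \<union> path_image c \<union> path_image k"
      using in_image unfolding p_image[symmetric] by auto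
    moreover have "path_image h \<inter> ?I = {}" "path_image k \<inter> ?I = {}"
      using h(3,5) k(3,5) IO by blast+
    ultimately show ?thesis
      using sub by blast
  qed
  then have "q ` {0<..<1} \<inter> (A \<union> B) = {}"
    using q_mid c(2) by blast
  moreover have "path_image q \<subseteq> J \<union> ?I"
    using q_image sub st by auto
  ultimately show ?thesis
    using that q by blast
qed

end

section \<open>Worst-case detectability\<close>

text \<open>If \<open>s\<close> lies from \<open>p\<close> towards \<open>b\<close>, or
  \<open>q\<close> lies on the perpendicular, the angle at \<open>p\<close> is at least a right one.
  Otherwise \<open>s\<close> lies between \<open>a\<close> and \<open>p\<close>, and \<open>dist s p
  \<le> dist a b - dist a s \<le> dist q a - dist a s \<le> dist s q\<close> by the triangle
  inequality.\<close>

lemma dist_le_beyond_perpendicular: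
  fixes a b p q s :: "'a::real_inner"
  assumes "p \<in> closed_segment a b" "s \<in> closed_segment a b"
    and half: "(q - p) \<bullet> (b - a) \<le> 0"
    and far: "dist a b \<le> dist q a \<or> (q - p) \<bullet> (b - a) = 0"
  shows "dist s p \<le> dist s q"
proof -
  obtain \<mu> \<sigma> where p: "0 \<le> \<mu>" "\<mu> \<le> 1" "p = a + \<mu> *\<^sub>R (b - a)"
      and s: "0 \<le> \<sigma>" "\<sigma> \<le> 1" "s = a + \<sigma> *\<^sub>R (b - a)"
    using assms(1,2) by (auto simp: closed_segment_def algebra_simps)
  have sp: "s - p = (\<sigma> - \<mu>) *\<^sub>R (b - a)"
    by (simp add: p(3) s(3) algebra_simps)
  show ?thesis
  proof (cases "(\<sigma> - \<mu>) * ((q - p) \<bullet> (b - a)) \<le> 0")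
    case True
    have "s - q = (s - p) - (q - p)"
      by simp
    then have "(norm (s - q))\<^sup>2 = (norm (s - p))\<^sup>2 - 2 * ((s - p) \<bullet> (q - p)) + (norm (q - p))\<^sup>2"
      by (simp only: power2_norm_eq_inner inner_diff_left inner_diff_right inner_commute)
        (simp add: inner_commute)
    moreover have "(s - p) \<bullet> (q - p) \<le> 0"
      using True unfolding sp by (simp add: inner_commute)
    ultimately have "(norm (s - p))\<^sup>2 \<le> (norm (s - q))\<^sup>2"
      by (smt (verit) zero_le_power2)
    then show ?thesis
      by (simp add: dist_norm power2_le_iff_abs_le)
  next
    case False
    then have "\<sigma> < \<mu>" and "dist a b \<le> dist q a"
      using half far by (auto simp: mult_le_0_iff)
    have "dist s p = (\<mu> - \<sigma>) * dist a b"
      using \<open>\<sigma> < \<mu>\<close> by (simp add: dist_norm sp norm_minus_commute)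
    also have "\<dots> \<le> (1 - \<sigma>) * dist a b"
      using p by (intro mult_right_mono) auto
    also have "\<dots> = dist a b - dist a s"
    proof -
      have "dist a s = \<sigma> * dist a b"
        using s(1) unfolding s(3) by (simp add: dist_norm norm_minus_commute)
      then show ?thesis
        by (simp add: algebra_simps)
    qed
    also have "\<dots> \<le> dist s q"
      using \<open>dist a b \<le> dist q a\<close> dist_triangle[of q a s] by (simp add: dist_commute)
    finally show ?thesis .
  qed
qed

lemma intensity_mono:
  assumes "M \<ge> 1" "N \<ge> 1"
    and "\<And>i. i \<in> {1..M} \<Longrightarrow> dist (T i) p \<le> dist (T i) q"
    and "\<And>j. j \<in> {1..N} \<Longrightarrow> dist (R j) p \<le> dist (R j) q"
  shows "intensity M T N R p \<le> intensity M T N R q"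
proof -
  let ?f = "\<lambda>p (i, j). dist (T i) p * dist (R j) p"
  let ?K = "{1..M} \<times> {1..N}"
  have "Min (?f q ` ?K) \<in> ?f q ` ?K"
    using assms(1,2) by (intro Min_in) auto
  then obtain i j where ij: "i \<in> {1..M}" "j \<in> {1..N}"
      "intensity M T N R q = dist (T i) q * dist (R j) q"
    unfolding intensity_def by auto
  have "intensity M T N R p \<le> dist (T i) p * dist (R j) p"
    unfolding intensity_def using ij(1,2) by (intro Min_le) (auto intro!: rev_image_eqI[of "(i, j)"])
  also have "\<dots> \<le> intensity M T N R q"
    unfolding ij(3) using assms(3)[OF ij(1)] assms(4)[OF ij(2)] by (intro mult_mono) auto
  finally show ?thesis .
qed

lemma four_sided_fieldE:
  assumes "four_sided_field F Fl Fe Fr Fd"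
  obtains gl ge gr gd where "four_arc_loop gl ge gr gd"
    "Fl = path_image gl" "Fe = path_image ge" "Fr = path_image gr" "Fd = path_image gd"
    "F = (Fl \<union> Fe \<union> Fr \<union> Fd) \<union> inside (Fl \<union> Fe \<union> Fr \<union> Fd)"
proof -
  have "DIM(real^2) = 2"
    by simp
  then show ?thesis
    using assms that unfolding four_sided_field_def four_arc_loop_def by metis
qed

lemma compact_four_sided_field:
  assumes "four_sided_field F Fl Fe Fr Fd"
  shows "compact F"
proof -
  obtain gl ge gr gd where "four_arc_loop gl ge gr gd"
    and g: "Fl = path_image gl" "Fe = path_image ge" "Fr = path_image gr" "Fd = path_image gd"
    and F: "F = (Fl \<union> Fe \<union> Fr \<union> Fd) \<union> inside (Fl \<union> Fe \<union> Fr \<union> Fd)"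
    using four_sided_fieldE[OF assms] .
  interpret four_arc_loop gl ge gr gd by fact
  have "compact (Fl \<union> Fe \<union> Fr \<union> Fd)"
    unfolding g by (intro compact_Un compact_sides)
  \<comment> \<open>The field is the complement of the open exterior.\<close>
  moreover have "closed F"
    unfolding F union_with_inside using Jordan(5) by (simp add: g closed_Compl)
  ultimately show ?thesis
    unfolding F by (simp add: compact_eq_bounded_closed bounded_inside)
qed

lemma intrusion_path_meets_connected_set:
  assumes "four_sided_field F Fl Fe Fr Fd" "intrusion_path F Fe Fd P"
    and "compact K" "connected K" "K \<subseteq> F" "a \<in> K \<inter> Fl" "b \<in> K \<inter> Fr"
  shows "path_image P \<inter> K \<noteq> {}"
proof -
  obtain gl ge gr gd where "four_arc_loop gl ge gr gd"
    and g: "Fl = path_image gl" "Fe = path_image ge" "Fr = path_image gr" "Fd = path_image gd"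
    and F: "F = (Fl \<union> Fe \<union> Fr \<union> Fd) \<union> inside (Fl \<union> Fe \<union> Fr \<union> Fd)"
    using four_sided_fieldE[OF assms(1)] .
  interpret four_arc_loop gl ge gr gd by fact
  show ?thesis
    using assms(2-) unfolding intrusion_path_def F g
    by (intro crossing[OF disjI1[OF conjI[OF refl refl]]]) auto
qed

text \<open>Every intrusion path meets \<open>K\<close>, and the intensity at a meeting point lies
  between the detectability of the path and the vulnerability of \<open>K\<close>.\<close>

lemma worst_case_detectability_le:
  assumes "four_sided_field F Fl Fe Fr Fd" "M \<ge> 1" "N \<ge> 1"
    and "compact K" "connected K" "K \<subseteq> F" "a \<in> K \<inter> Fl" "b \<in> K \<inter> Fr"
  shows "worst_case_detectability M T N R F Fe Fd \<le> vulnerability M T N R K"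
  unfolding worst_case_detectability_def
proof (rule cSUP_least)
  show "{P. intrusion_path F Fe Fd P} \<noteq> {}"
    using intrusion_path_exists[OF assms(1)] by auto
next
  fix P assume "P \<in> {P. intrusion_path F Fe Fd P}"
  then have P: "intrusion_path F Fe Fd P" by simp
  then obtain q where q: "q \<in> path_image P" "q \<in> K"
    using intrusion_path_meets_connected_set[OF assms(1) P assms(4-)] by blast
  then have "path_detectability M T N R P \<le> intensity M T N R q"
    using path_detectability_attained[OF assms(2,3), of P T R] P by (auto simp: intrusion_path_def)
  also have "\<dots> \<le> vulnerability M T N R K"
    using vulnerability_attained[OF assms(2-4), of T R] q(2) by fastforce
  finally show "path_detectability M T N R P \<le> vulnerability M T N R K" .
qed

lemma intrusion_path_between:
  assumes "four_sided_field F Fl Fe Fr Fd"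
    and "compact A" "Fl \<subseteq> A" "compact B" "Fr \<subseteq> B" "A \<inter> B = {}" "A \<union> B \<subseteq> F"
  obtains P where "intrusion_path F Fe Fd P" "P ` {0<..<1} \<inter> (A \<union> B) = {}"
proof -
  obtain gl ge gr gd where "four_arc_loop gl ge gr gd"
    and g: "Fl = path_image gl" "Fe = path_image ge" "Fr = path_image gr" "Fd = path_image gd"
    and F: "F = (Fl \<union> Fe \<union> Fr \<union> Fd) \<union> inside (Fl \<union> Fe \<union> Fr \<union> Fd)"
    using four_sided_fieldE[OF assms(1)] .
  interpret four_arc_loop gl ge gr gd by fact
  obtain P where "path P" "path_image P \<subseteq> F" "pathstart P \<in> Fe" "pathfinish P \<in> Fd"
      "P ` {0<..<1} \<inter> (A \<union> B) = {}"
    using path_between_disjoint_compacts[OF assms(2) _ assms(4) _ assms(6)] assms(3,5,7)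
    unfolding F g by blast
  then show ?thesis
    by (intro that[of P]) (auto simp: intrusion_path_def)
qed

lemma worst_case_detectability_ge:
  assumes field: "four_sided_field F Fl Fe Fr Fd" and MN: "M \<ge> 1" "N \<ge> 1"
    and ab: "a \<in> Fl" "b \<in> Fr" "dist a b = setdist Fl Fr"
    and T: "\<And>i. i \<in> {1..M} \<Longrightarrow> T i \<in> closed_segment a b"
    and R: "\<And>j. j \<in> {1..N} \<Longrightarrow> R j \<in> closed_segment a b"
    and p: "p \<in> closed_segment a b"
  shows "intensity M T N R p \<le> worst_case_detectability M T N R F Fe Fd"
proof (rule field_le_epsilon)
  fix \<epsilon> :: real assume "\<epsilon> > 0"
  let ?I = "intensity M T N R"
  \<comment> \<open>Lowering the threshold by \<epsilon> makes the set to be avoided closed while it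
    still misses every point of intensity at least \<open>?I p\<close>.\<close>
  define U where "U = {q. ?I q \<le> ?I p - \<epsilon>}"
  define HL HR where "HL = {q. (q - p) \<bullet> (b - a) \<le> 0}" and "HR = {q. (q - p) \<bullet> (b - a) \<ge> 0}"
  have closed: "closed U" "closed HL" "closed HR"
    unfolding U_def HL_def HR_def
    by (intro closed_Collect_le continuous_intros continuous_on_intensity MN)+
  have U_I: "q \<notin> U" if "?I p \<le> ?I q" for q
    using that \<open>\<epsilon> > 0\<close> by (simp add: U_def)
  have far_Fr: "dist a b \<le> dist q a" if "q \<in> Fr" for q
    using setdist_le_dist[OF ab(1) that] ab(3) by (simp add: dist_commute)
  have far_Fl: "dist b a \<le> dist q b" if "q \<in> Fl" for q
    using setdist_le_dist[OF that ab(2)] ab(3) by (simp add: dist_commute)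
  \<comment> \<open>This covers two cases of \<open>dist_le_beyond_perpendicular\<close>: points of
    the right boundary on the side of \<open>a\<close>, which are far from \<open>a\<close>, and
    points on the perpendicular itself.\<close>
  have left: "q \<notin> U" if "q \<in> HL" "q \<in> Fr \<or> q \<in> HR" for q
  proof -
    have "dist s p \<le> dist s q" if "s \<in> closed_segment a b" for s
      using \<open>q \<in> HL\<close> \<open>q \<in> Fr \<or> q \<in> HR\<close> far_Fr[of q]
      by (intro dist_le_beyond_perpendicular[OF p that]) (auto simp: HL_def HR_def)
    with T R show ?thesis
      by (intro U_I intensity_mono MN) blast+
  qed
  \<comment> \<open>The mirror image, with \<open>a\<close> and \<open>b\<close> exchanged.\<close>
  have right: "q \<notin> U" if "q \<in> HR" "q \<in> Fl" for q
  proof -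
    have "(q - p) \<bullet> (a - b) \<le> 0"
      using \<open>q \<in> HR\<close> by (simp add: HR_def inner_diff_right)
    then have "dist s p \<le> dist s q" if "s \<in> closed_segment a b" for s
      using far_Fl[OF \<open>q \<in> Fl\<close>] p that
      by (intro dist_le_beyond_perpendicular[of p b a s q]) (auto simp: closed_segment_commute)
    with T R show ?thesis
      by (intro U_I intensity_mono MN) blast+
  qed
  obtain gl ge gr gd where "four_arc_loop gl ge gr gd"
    and g: "Fl = path_image gl" "Fe = path_image ge" "Fr = path_image gr" "Fd = path_image gd"
    and F: "F = (Fl \<union> Fe \<union> Fr \<union> Fd) \<union> inside (Fl \<union> Fe \<union> Fr \<union> Fd)"
    using four_sided_fieldE[OF field] .
  interpret loop: four_arc_loop gl ge gr gd by fact
  have sides: "compact Fl" "compact Fr" "Fl \<inter> Fr = {}" "Fl \<union> Fr \<subseteq> F"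
    using loop.compact_sides loop.disjoint_sides F by (auto simp: g)
  obtain P where P: "intrusion_path F Fe Fd P"
      and avoid: "P ` {0<..<1} \<inter> ((Fl \<union> (F \<inter> (U \<inter> HL))) \<union> (Fr \<union> (F \<inter> (U \<inter> HR)))) = {}"
  proof (rule intrusion_path_between[OF field])
    show "compact (Fl \<union> (F \<inter> (U \<inter> HL)))" "compact (Fr \<union> (F \<inter> (U \<inter> HR)))"
      using closed compact_four_sided_field[OF field] sides
      by (auto intro!: compact_Un compact_Int_closed closed_Int)
    \<comment> \<open>Of the four intersections, the two sides are disjoint, \<open>right\<close>
      excludes \<open>Fl\<close> with the second part, and \<open>left\<close> excludes both
      \<open>Fr\<close> with the first part and a common point of the two parts.\<close>
    show "(Fl \<union> (F \<inter> (U \<inter> HL))) \<inter> (Fr \<union> (F \<inter> (U \<inter> HR))) = {}"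
      using sides left right by blast
    show "(Fl \<union> (F \<inter> (U \<inter> HL))) \<union> (Fr \<union> (F \<inter> (U \<inter> HR))) \<subseteq> F"
      using sides by blast
  qed auto
  have path: "path P" "path_image P \<subseteq> F"
    using P by (auto simp: intrusion_path_def)
  have interior: "?I p - \<epsilon> \<le> ?I (P t)" if "t \<in> {0<..<1}" for t
  proof -
    have "P t \<in> F"
      using path(2) that by (auto simp: path_image_def)
    moreover have "P t \<in> HL \<union> HR"
      by (auto simp: HL_def HR_def)
    ultimately have "P t \<notin> U"
      using avoid that by blast
    then show ?thesis
      by (simp add: U_def)
  qed
  \<comment> \<open>The end points of \<open>P\<close> may lie in the avoided sets; continuity
    extends the bound to them.\<close>
  have "?I p - \<epsilon> \<le> ?I (P t)" if "t \<in> {0..1}" for t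
  proof (rule continuous_ge_on_closure[of "{0<..<1}" "\<lambda>t. ?I (P t)"])
    show "continuous_on (closure {0<..<1}) (\<lambda>t. ?I (P t))"
      using path(1) continuous_on_compose2[OF continuous_on_intensity[OF MN, of UNIV T R]]
      by (simp add: path_def)
  qed (use interior that in auto)
  then have "?I p - \<epsilon> \<le> path_detectability M T N R P"
    using path_detectability_attained[OF MN path(1), of T R] by (auto simp: path_image_def)
  also have "\<dots> \<le> worst_case_detectability M T N R F Fe Fd"
    unfolding worst_case_detectability_def
    using path_detectability_bdd_above[OF MN field] P by (intro cSUP_upper) auto
  finally show "?I p \<le> worst_case_detectability M T N R F Fe Fd + \<epsilon>"
    by simp
qed

theorem theorem2:
  fixes F Fl Fe Fr Fd :: "(real^2) set"
    and a b :: "real^2"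
    and M N :: nat
    and T R :: "nat \<Rightarrow> real^2"
  assumes "four_sided_field F Fl Fe Fr Fd"
    and "a \<in> Fl" and "b \<in> Fr"
    and "dist a b = setdist Fl Fr"
    and "closed_segment a b \<subseteq> F"
    and "M \<ge> 1" and "N \<ge> 1"
    and "\<And>i. i \<in> {1..M} \<Longrightarrow> T i \<in> closed_segment a b"
    and "\<And>j. j \<in> {1..N} \<Longrightarrow> R j \<in> closed_segment a b"
  shows "worst_case_detectability M T N R F Fe Fd = vulnerability M T N R (closed_segment a b)"
proof (rule antisym)
  show "worst_case_detectability M T N R F Fe Fd \<le> vulnerability M T N R (closed_segment a b)"
    using assms(2,3,5) by (intro worst_case_detectability_le[OF assms(1,6,7), where a = a and b = b]) auto
  show "vulnerability M T N R (closed_segment a b) \<le> worst_case_detectability M T N R F Fe Fd"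
    unfolding vulnerability_def
    using worst_case_detectability_ge[OF assms(1,6,7,2,3,4,8,9)] by (intro cSUP_least) auto
qed

end
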